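(* Suppose that for all $Y\in\mathcal Y^d$, $R(Y)\in\mathcal F(\mathbb R^d;\mathbb R^d_+)$ and $R_0(Y)$ equals the topological boundary $\partial R(Y)$. Suppose that $V_{R_0}\colon\mathbb R^d\times\mathbb R^d\to\mathbb R$ is an oriented strict selective $\mathcal M^d$-identification function for $R_0$ which is positively homogeneous of degree $a\in\mathbb R$, and let $S_{R,k}(A,y)=\big(\mathbf 1_{R(y)\setminus A}(k)-\mathbf 1_{A\setminus R(y)}(k)\big)V_{R_0}(k,y)$. (i) Let $\pi$ be a non-negative $\sigma$-finite measure on $\mathcal B(\mathbb R^d)$ that is positively homogeneous of degree $b\in\mathbb R$. Then the scoring function $$S_{R,\pi}(A,y)=\int_{\mathbb R^d}S_{R,k}(A,y)\,\pi(dk),\qquad A\in\mathcal F(\mathbb R^d;\mathbb R^d_+),\ y\in\mathbb R^d,$$ is positively homogeneous of degree $a+b$. (ii) Let $b\in\mathbb R$. Any finite $\mathcal M^d$-consistent scoring function $S$ for $R$ of the form $S(A,y)=\int_{\mathbb R^d}S_{R,k}(A,y)\,\pi'(dk)$, with $\pi'$ a $\sigma$-finite non-negative measure on $\mathcal B(\mathbb R^d)$, is positively homogeneous of degree $a+b$ only if $S(A,y)=\gamma S_{R,\pi}(A,y)$ for some $\gamma\ge0$ and some non-negative $\sigma$-finite measure $\pi$ that is positively homogeneous of degree $b$.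
   Context: Setting: $(\Omega,\mathfrak F,\mathbb P)$ is an atomless probability space, $d\ge1$, $\mathcal Y^d\subseteq L^0(\Omega;\mathbb R^d)$ is a non-empty class of random vectors closed under translation by constants $k\in\mathbb R^d$. $\Lambda\colon\mathbb R^d\to\mathbb R$ is an aggregation function, i.e. non-decreasing for the componentwise order. $\mathcal Y\subseteq L^0(\Omega;\mathbb R)$ contains $\Lambda(Y)$ for all $Y\in\mathcal Y^d$ and is closed under translation by constants. $\mathcal M^d$ is the class of distributions of elements of $\mathcal Y^d$. $\rho\colon\mathcal Y\to\mathbb R$ is a law-invariant scalar risk measure that is cash-invariant ($\rho(X+m)=\rho(X)-m$) and monotone ($X\ge Z$ a.s. implies $\rho(X)\le\rho(Z)$). Define $R(Y)=\{k\in\mathbb R^d:\rho(\Lambda(Y+k))\le0\}$ and $R_0(Y)=\{k\in\mathbb R^d:\rho(\Lambda(Y+k))=0\}$; these are law-invariant and we write $R(F_Y)=R(Y)$, $R_0(F_Y)=R_0(Y)$. For $y\in\mathbb R^d$, $R(y):=R(\delta_y)=\{k:\rho(\Lambda(y+k))\le0\}$, where $\rho$ is understood to be defined (with the same properties) on constants as well. $\mathcal F(\mathbb R^d;\mathbb R^d_+)$ is the class of closed sets $B\subseteq\mathbb R^d$ with $B=B+\mathbb R^d_+$ (closed upper sets, $\emptyset$ allowed) and $B\ne\mathbb R^d$. Write $\bar V(k,F)=\int V(k,y)\,dF(y)$, $\bar S(A,F)=\int S(A,y)\,dF(y)$; all integrals are tacitly assumed well defined (in particular $V_{R_0}$ and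 integrands are jointly measurable). $V_{R_0}$ is an oriented strict selective $\mathcal M^d$-identification function for $R_0$ if for all $F\in\mathcal M^d$, $k\in\mathbb R^d$: $\bar V_{R_0}(k,F)<0$ if $k\notin R(F)$, $=0$ if $k\in R_0(F)$, $>0$ if $k\in R(F)\setminus R_0(F)$. As a standing requirement for the scores $S_{R,k}$ to be non-negative, $V_{R_0}$ satisfies, also at point masses, $V_{R_0}(k,y)\ge0$ if $k\in R(y)$ and $V_{R_0}(k,y)\le0$ if $k\notin R(y)$. Positive homogeneity: $V_{R_0}$ is positively homogeneous of degree $a$ if $V_{R_0}(ck,cy)=c^aV_{R_0}(k,y)$; a measure $\pi$ is positively homogeneous of degree $b$ if $\pi(cA)=c^b\pi(A)$ for all $A\in\mathcal B(\mathbb R^d)$; a score $S$ is positively homogeneous of degree $s$ if $S(cA,cy)=c^sS(A,y)$ for all $A\in\mathcal F(\mathbb R^d;\mathbb R^d_+)$, $y\in\mathbb R^d$; in each case for all $c>0$. A score $S\colon\mathcal F(\mathbb R^d;\mathbb R^d_+)\times\mathbb R^d\to[0,\infty]$ is $\mathcal M^d$-consistent for $R$ if $\bar S(R(F),F)\le\bar S(A,F)$ for all $A\in\mathcal F(\mathbb R^d;\mathbb R^d_+)$, $F\in\mathcal M^d$; it is finite if it takes only finite values. *)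

theory Defs
  imports "HOL-Probability.Probability"
begin

definition atomless :: "'w measure \<Rightarrow> bool" where
  "atomless M \<longleftrightarrow> (\<forall>A\<in>sets M. 0 < emeasure M A \<longrightarrow>
     (\<exists>B\<in>sets M. B \<subseteq> A \<and> 0 < emeasure M B \<and> emeasure M B < emeasure M A))"

text \<open>Random variables and vectors are represented by measurable functions rather than by
  almost-sure equivalence classes, and the dimension is the cardinality of the index type
  \<open>'d\<close>, so it is at least 1.  The order on \<open>real ^ 'd\<close> is the componentwise one.  The risk
  measure is a total function in HOL; its properties are required only on \<open>\<Y>\<close> and on the
  constant random variables, which are needed for the values of \<open>R\<close> at point masses.\<close>

locale systemic_risk_setting = prob_space M for M :: "'w measure" +
  fixes \<Y>d :: "('w \<Rightarrow> real ^ 'd) set"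
    and \<Y> :: "('w \<Rightarrow> real) set"
    and \<Lambda> :: "real ^ 'd \<Rightarrow> real"
    and \<rho> :: "('w \<Rightarrow> real) \<Rightarrow> real"
  assumes atomless: "atomless M"
    and vectors_measurable: "\<Y>d \<subseteq> borel_measurable M"
    and vectors_nonempty: "\<Y>d \<noteq> {}"
    and vectors_translate: "\<And>Y k. Y \<in> \<Y>d \<Longrightarrow> (\<lambda>\<omega>. Y \<omega> + k) \<in> \<Y>d"
    and aggregation_mono: "mono \<Lambda>"
    and scalars_measurable: "\<Y> \<subseteq> borel_measurable M"
    and scalars_aggregated: "\<And>Y. Y \<in> \<Y>d \<Longrightarrow> (\<lambda>\<omega>. \<Lambda> (Y \<omega>)) \<in> \<Y>"
    and scalars_translate: "\<And>X m. X \<in> \<Y> \<Longrightarrow> (\<lambda>\<omega>. X \<omega> + m) \<in> \<Y>"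
    and law_invariant: "\<And>X Z. X \<in> \<Y> \<union> range (\<lambda>c _. c) \<Longrightarrow> Z \<in> \<Y> \<union> range (\<lambda>c _. c) \<Longrightarrow>
          distr M borel X = distr M borel Z \<Longrightarrow> \<rho> X = \<rho> Z"
    and cash_invariant: "\<And>X m. X \<in> \<Y> \<union> range (\<lambda>c _. c) \<Longrightarrow> \<rho> (\<lambda>\<omega>. X \<omega> + m) = \<rho> X - m"
    and monotone: "\<And>X Z. X \<in> \<Y> \<union> range (\<lambda>c _. c) \<Longrightarrow> Z \<in> \<Y> \<union> range (\<lambda>c _. c) \<Longrightarrow>
          (AE \<omega> in M. Z \<omega> \<le> X \<omega>) \<Longrightarrow> \<rho> X \<le> \<rho> Z"

definition risk_set ::
    "(('w \<Rightarrow> real) \<Rightarrow> real) \<Rightarrow> (real ^ 'd \<Rightarrow> real) \<Rightarrow> ('w \<Rightarrow> real ^ 'd) \<Rightarrow> (real ^ 'd) set" where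
  "risk_set \<rho> \<Lambda> Y = {k. \<rho> (\<lambda>\<omega>. \<Lambda> (Y \<omega> + k)) \<le> 0}"

definition risk_set0 ::
    "(('w \<Rightarrow> real) \<Rightarrow> real) \<Rightarrow> (real ^ 'd \<Rightarrow> real) \<Rightarrow> ('w \<Rightarrow> real ^ 'd) \<Rightarrow> (real ^ 'd) set" where
  "risk_set0 \<rho> \<Lambda> Y = {k. \<rho> (\<lambda>\<omega>. \<Lambda> (Y \<omega> + k)) = 0}"

definition risk_set_pt ::
    "(('w \<Rightarrow> real) \<Rightarrow> real) \<Rightarrow> (real ^ 'd \<Rightarrow> real) \<Rightarrow> real ^ 'd \<Rightarrow> (real ^ 'd) set" where
  "risk_set_pt \<rho> \<Lambda> y = risk_set \<rho> \<Lambda> (\<lambda>_. y)"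

definition closed_upper_sets :: "(real ^ 'd) set set" where
  "closed_upper_sets = {B. closed B \<and> B = {b + x | b x. b \<in> B \<and> 0 \<le> x} \<and> B \<noteq> UNIV}"

text \<open>The integral of a real function in the extended sense: it exists as soon as the positive
  or the negative part has finite integral, and may then be infinite.\<close>

definition has_ext_integral :: "'a measure \<Rightarrow> ('a \<Rightarrow> real) \<Rightarrow> bool" where
  "has_ext_integral F f \<longleftrightarrow> f \<in> borel_measurable F \<and>
     ((\<integral>\<^sup>+ y. ennreal (f y) \<partial>F) < \<infinity> \<or> (\<integral>\<^sup>+ y. ennreal (- f y) \<partial>F) < \<infinity>)"

definition ext_integral :: "'a measure \<Rightarrow> ('a \<Rightarrow> real) \<Rightarrow> ereal" where
  "ext_integral F f =
     enn2ereal (\<integral>\<^sup>+ y. ennreal (f y) \<partial>F) - enn2ereal (\<integral>\<^sup>+ y. ennreal (- f y) \<partial>F)"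

lemma ext_integral_eq_integral:
  assumes "integrable F f"
  shows "has_ext_integral F f" "ext_integral F f = ereal (integral\<^sup>L F f)"
proof -
  have p: "(\<integral>\<^sup>+ y. ennreal (f y) \<partial>F) < \<infinity>" and n: "(\<integral>\<^sup>+ y. ennreal (- f y) \<partial>F) < \<infinity>"
    using assms by (auto simp: real_integrable_def less_top)
  show "has_ext_integral F f"
    using assms p by (auto simp: has_ext_integral_def)
  have "enn2ereal x = ereal (enn2real x)" if "x < \<infinity>" for x
    using that by (cases x) (auto simp: enn2ereal_ennreal)
  then show "ext_integral F f = ereal (integral\<^sup>L F f)"
    using p n real_lebesgue_integral_def[OF assms] by (simp add: ext_integral_def)
qed

text \<open>The distributions \<open>F\<close> of the class are exactly the laws of the members of \<open>\<Y>d\<close>, and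
  \<open>R(F)\<close> stands for \<open>R(Y)\<close> whenever \<open>Y\<close> has law \<open>F\<close>; quantification over \<open>F\<close> is therefore
  written as quantification over \<open>Y \<in> \<Y>d\<close> with \<open>F = distr M borel Y\<close>.\<close>

definition oriented_strict_selective_identification ::
    "'w measure \<Rightarrow> ('w \<Rightarrow> real ^ 'd) set \<Rightarrow> (('w \<Rightarrow> real) \<Rightarrow> real) \<Rightarrow> (real ^ 'd \<Rightarrow> real) \<Rightarrow>
     (real ^ 'd \<Rightarrow> real ^ 'd \<Rightarrow> real) \<Rightarrow> bool" where
  "oriented_strict_selective_identification M \<Y>d \<rho> \<Lambda> V \<longleftrightarrow>
     (\<forall>Y\<in>\<Y>d. \<forall>k. let F = distr M borel Y in
        has_ext_integral F (V k) \<and>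
        (k \<notin> risk_set \<rho> \<Lambda> Y \<longrightarrow> ext_integral F (V k) < 0) \<and>
        (k \<in> risk_set0 \<rho> \<Lambda> Y \<longrightarrow> ext_integral F (V k) = 0) \<and>
        (k \<in> risk_set \<rho> \<Lambda> Y - risk_set0 \<rho> \<Lambda> Y \<longrightarrow> ext_integral F (V k) > 0))"

definition pointwise_oriented ::
    "(('w \<Rightarrow> real) \<Rightarrow> real) \<Rightarrow> (real ^ 'd \<Rightarrow> real) \<Rightarrow>
     (real ^ 'd \<Rightarrow> real ^ 'd \<Rightarrow> real) \<Rightarrow> bool" where
  "pointwise_oriented \<rho> \<Lambda> V \<longleftrightarrow>
     (\<forall>k y. (k \<in> risk_set_pt \<rho> \<Lambda> y \<longrightarrow> V k y \<ge> 0) \<and> (k \<notin> risk_set_pt \<rho> \<Lambda> y \<longrightarrow> V k y \<le> 0))"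

definition elementary_score ::
    "(('w \<Rightarrow> real) \<Rightarrow> real) \<Rightarrow> (real ^ 'd \<Rightarrow> real) \<Rightarrow> (real ^ 'd \<Rightarrow> real ^ 'd \<Rightarrow> real) \<Rightarrow>
     real ^ 'd \<Rightarrow> (real ^ 'd) set \<Rightarrow> real ^ 'd \<Rightarrow> real" where
  "elementary_score \<rho> \<Lambda> V k A y =
     (indicator (risk_set_pt \<rho> \<Lambda> y - A) k - indicator (A - risk_set_pt \<rho> \<Lambda> y) k) * V k y"

lemma elementary_score_nonneg:
  "pointwise_oriented \<rho> \<Lambda> V \<Longrightarrow> 0 \<le> elementary_score \<rho> \<Lambda> V k A y"
  by (auto simp: pointwise_oriented_def elementary_score_def indicator_def)

text \<open>The integrand below is non-negative by the preceding lemma whenever \<open>V\<close> has the required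
  signs at point masses, so the conversion to \<open>ennreal\<close> does not truncate.\<close>

definition mixture_score ::
    "(('w \<Rightarrow> real) \<Rightarrow> real) \<Rightarrow> (real ^ 'd \<Rightarrow> real) \<Rightarrow> (real ^ 'd \<Rightarrow> real ^ 'd \<Rightarrow> real) \<Rightarrow>
     (real ^ 'd) measure \<Rightarrow> (real ^ 'd) set \<Rightarrow> real ^ 'd \<Rightarrow> ennreal" where
  "mixture_score \<rho> \<Lambda> V \<pi> A y = (\<integral>\<^sup>+ k. ennreal (elementary_score \<rho> \<Lambda> V k A y) \<partial>\<pi>)"

definition borel_sigma_finite :: "(real ^ 'd) measure \<Rightarrow> bool" where
  "borel_sigma_finite \<pi> \<longleftrightarrow> sets \<pi> = sets borel \<and> sigma_finite_measure \<pi>"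

definition pos_homogeneous_fun :: "real \<Rightarrow> (real ^ 'd \<Rightarrow> real ^ 'd \<Rightarrow> real) \<Rightarrow> bool" where
  "pos_homogeneous_fun a V \<longleftrightarrow> (\<forall>c>0. \<forall>k y. V (c *\<^sub>R k) (c *\<^sub>R y) = c powr a * V k y)"

definition pos_homogeneous_measure :: "real \<Rightarrow> (real ^ 'd) measure \<Rightarrow> bool" where
  "pos_homogeneous_measure b \<pi> \<longleftrightarrow>
     (\<forall>c>0. \<forall>A\<in>sets borel. emeasure \<pi> ((\<lambda>k. c *\<^sub>R k) ` A) = ennreal (c powr b) * emeasure \<pi> A)"

definition pos_homogeneous_score ::
    "real \<Rightarrow> ((real ^ 'd) set \<Rightarrow> real ^ 'd \<Rightarrow> ennreal) \<Rightarrow> bool" where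
  "pos_homogeneous_score s S \<longleftrightarrow> (\<forall>c>0. \<forall>A\<in>closed_upper_sets. \<forall>y.
     S ((\<lambda>k. c *\<^sub>R k) ` A) (c *\<^sub>R y) = ennreal (c powr s) * S A y)"

definition consistent_score ::
    "'w measure \<Rightarrow> ('w \<Rightarrow> real ^ 'd) set \<Rightarrow> (('w \<Rightarrow> real) \<Rightarrow> real) \<Rightarrow> (real ^ 'd \<Rightarrow> real) \<Rightarrow>
     ((real ^ 'd) set \<Rightarrow> real ^ 'd \<Rightarrow> ennreal) \<Rightarrow> bool" where
  "consistent_score M \<Y>d \<rho> \<Lambda> S \<longleftrightarrow> (\<forall>Y\<in>\<Y>d. \<forall>A\<in>closed_upper_sets.
     (\<integral>\<^sup>+ y. S (risk_set \<rho> \<Lambda> Y) y \<partial>distr M borel Y) \<le> (\<integral>\<^sup>+ y. S A y \<partial>distr M borel Y))"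

definition finite_score :: "((real ^ 'd) set \<Rightarrow> real ^ 'd \<Rightarrow> ennreal) \<Rightarrow> bool" where
  "finite_score S \<longleftrightarrow> (\<forall>A\<in>closed_upper_sets. \<forall>y. S A y < \<infinity>)"

end

theory Submission
  imports Defs
begin

text \<open>By the sign condition on \<open>V\<close>, the elementary score equals \<open>V\<^sup>-\<close> on \<open>A\<close> and \<open>V\<^sup>+\<close> off
  \<open>A\<close>, so \<open>R(y)\<close> disappears from it and part (i) is a change of variables.  For part (ii), a
  finite mixture score determines its mixing measure: the scores of closed upper orthants and
  of \<open>{}\<close> determine the signed measure \<open>V(\<cdot>, y) d\<pi>\<close>, hence \<open>\<pi>\<close> on each set
  \<open>{k. V(k, y) < 0}\<close>.  These sets are uncountably many, but since \<open>R(Y)\<close> is closed and not the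
  whole space, countably many translates of one \<open>Y\<close> suffice to give every \<open>k\<close> a law \<open>F\<close> with
  negative mean of \<open>V(k, \<cdot>)\<close>, and Fubini's theorem glues the pieces.  As rescaling \<open>\<pi>'\<close>
  reproduces a homogeneous score, \<open>\<pi>'\<close> is itself homogeneous, and \<open>\<gamma> = 1\<close>.\<close>

section \<open>Scores without the risk set at a point\<close>

lemma elementary_score_eq:
  assumes "pointwise_oriented \<rho> \<Lambda> V"
  shows "elementary_score \<rho> \<Lambda> V k A y =
    (if k \<in> A then max 0 (- V k y) else max 0 (V k y))"
proof -
  have "k \<in> risk_set_pt \<rho> \<Lambda> y \<Longrightarrow> V k y \<ge> 0" "k \<notin> risk_set_pt \<rho> \<Lambda> y \<Longrightarrow> V k y \<le> 0"
    using assms by (auto simp: pointwise_oriented_def)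
  then show ?thesis
    by (cases "k \<in> risk_set_pt \<rho> \<Lambda> y") (auto simp: elementary_score_def indicator_def max_def)
qed

text \<open>Since \<open>ennreal\<close> sends negative reals to 0, the truncation by
  \<open>max 0\<close> is absorbed.\<close>

lemma mixture_score_eq:
  assumes "pointwise_oriented \<rho> \<Lambda> V"
  shows "mixture_score \<rho> \<Lambda> V \<pi> A y =
    (\<integral>\<^sup>+ k. (if k \<in> A then ennreal (- V k y) else ennreal (V k y)) \<partial>\<pi>)"
  unfolding mixture_score_def elementary_score_eq[OF assms]
  by (intro nn_integral_cong) (auto simp: max_def ennreal_neg)

section \<open>Equality criteria for measures\<close>

text \<open>Sums of measures serve later to express an identity between signed measures without
  subtraction.\<close>

lemma emeasure_sum_measure_exists:
  assumes "sets N = sets M"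
  shows "\<exists>K. sets K = sets M \<and> (\<forall>A\<in>sets M. emeasure K A = emeasure M A + emeasure N A)"
proof -
  let ?\<mu> = "\<lambda>A. emeasure M A + emeasure N A"
  let ?K = "measure_of (space M) (sets M) ?\<mu>"
  have "countably_additive (sets M) ?\<mu>"
  proof (rule countably_additiveI)
    fix A :: "nat \<Rightarrow> _" assume A: "range A \<subseteq> sets M" "disjoint_family A" "\<Union> (range A) \<in> sets M"
    then have "(\<Sum>i. emeasure M (A i)) = emeasure M (\<Union> (range A))"
      "(\<Sum>i. emeasure N (A i)) = emeasure N (\<Union> (range A))"
      by (auto intro!: suminf_emeasure simp: assms)
    then show "(\<Sum>i. ?\<mu> (A i)) = ?\<mu> (\<Union> (range A))"
      by (simp add: suminf_add[symmetric])
  qed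
  then have "A \<in> sets M \<Longrightarrow> emeasure ?K A = ?\<mu> A" for A
    by (intro emeasure_measure_of_sigma) (auto simp: positive_def sets.sigma_algebra_axioms)
  then show ?thesis
    by (intro exI[of _ ?K]) auto
qed

text \<open>Disjointing the cover splits a measurable set into countably many pieces, each inside
  one \<open>C n\<close>, and countable additivity adds up the agreement.\<close>

lemma emeasure_eq_countable_cover:
  fixes C :: "nat \<Rightarrow> 'a set"
  assumes sets: "sets N = sets M" and C: "range C \<subseteq> sets M" "space M \<subseteq> (\<Union>n. C n)"
    and eq: "\<And>n B. B \<in> sets M \<Longrightarrow> B \<subseteq> C n \<Longrightarrow> emeasure M B = emeasure N B"
  shows "M = N"
proof (rule measure_eqI)
  fix B assume B: "B \<in> sets M"
  let ?D = "\<lambda>n. B \<inter> disjointed C n"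
  have D: "?D n \<in> sets M" for n
    using B sets.range_disjointed_sets[OF C(1)] by auto
  have dis: "disjoint_family ?D"
    using disjoint_family_disjointed[of C] by (auto simp: disjoint_family_on_def)
  have un: "(\<Union>n. ?D n) = B"
    using C(2) sets.sets_into_space[OF B] UN_disjointed_eq[of C] by blast
  have "emeasure M B = (\<Sum>n. emeasure M (?D n))"
    using suminf_emeasure[of ?D M] D dis un by (metis image_subset_iff)
  also have "\<dots> = (\<Sum>n. emeasure N (?D n))"
    using eq[OF D] disjointed_subset[of C] by (metis Int_lower2 order_trans)
  also have "\<dots> = emeasure N B"
    using suminf_emeasure[of ?D N] D dis un sets by (metis image_subset_iff)
  finally show "emeasure M B = emeasure N B" .
qed (simp add: sets)

text \<open>On its support \<open>f\<close> is finite and non-zero, so this density can be divided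
  out of both measures.\<close>

lemma emeasure_eq_on_support:
  fixes f :: "'a \<Rightarrow> ennreal"
  assumes sets: "sets N = sets M" and f: "f \<in> borel_measurable M"
    and fin: "\<And>x. f x < \<infinity>"
    and eq: "\<And>B. B \<in> sets M \<Longrightarrow> B \<subseteq> {x. f x \<noteq> 0} \<Longrightarrow>
      (\<integral>\<^sup>+ x. f x * indicator B x \<partial>M) = (\<integral>\<^sup>+ x. f x * indicator B x \<partial>N)"
    and B: "B \<in> sets M" "B \<subseteq> {x. f x \<noteq> 0}"
  shows "emeasure M B = emeasure N B"
proof -
  note f[measurable] B(1)[measurable]
  have [measurable]: "f \<in> borel_measurable N" "B \<in> sets N"
    using f B(1) sets measurable_cong_sets[OF sets refl] by auto
  \<comment> \<open>Cutting \<open>f\<close> off outside \<open>B\<close> turns the agreement below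
    the support into equality of two measures on the whole space.\<close>
  define g where "g x = f x * indicator B x" for x
  have [measurable]: "g \<in> borel_measurable M" "g \<in> borel_measurable N"
    unfolding g_def by measurable
  have "density M g = density N g"
  proof (rule measure_eqI)
    fix C assume C: "C \<in> sets (density M g)"
    then have [measurable]: "C \<in> sets M" "C \<in> sets N" by (auto simp: sets)
    have "emeasure (density M g) C = (\<integral>\<^sup>+ x. f x * indicator (B \<inter> C) x \<partial>M)"
      by (subst emeasure_density) (auto simp: g_def indicator_def intro!: nn_integral_cong)
    also have "\<dots> = (\<integral>\<^sup>+ x. f x * indicator (B \<inter> C) x \<partial>N)"
      using B by (intro eq) auto
    also have "\<dots> = emeasure (density N g) C"
      by (subst emeasure_density) (auto simp: g_def indicator_def intro!: nn_integral_cong)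
    finally show "emeasure (density M g) C = emeasure (density N g) C" .
  qed (simp add: sets)
  \<comment> \<open>Weighting by \<open>1 / f\<close> on \<open>B\<close> recovers the mass of
    \<open>B\<close>; \<open>L\<close> will be both \<open>M\<close> and \<open>N\<close>.\<close>
  moreover have "(\<integral>\<^sup>+ x. indicator B x / f x \<partial>density L g) = emeasure L B"
    if [measurable]: "f \<in> borel_measurable L" "g \<in> borel_measurable L" "B \<in> sets L" for L
  proof -
    have "(\<integral>\<^sup>+ x. indicator B x / f x \<partial>density L g) = (\<integral>\<^sup>+ x. g x * (indicator B x / f x) \<partial>L)"
      by (subst nn_integral_density) auto
    also have "\<dots> = (\<integral>\<^sup>+ x. indicator B x \<partial>L)"
      using B(2) fin
      by (intro nn_integral_cong)
        (auto simp: g_def indicator_def ennreal_times_divide less_top intro!: ennreal_divide_self)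
    finally show ?thesis by simp
  qed
  ultimately show ?thesis
    by (metis \<open>f \<in> borel_measurable N\<close> \<open>B \<in> sets N\<close> f B(1)
        \<open>g \<in> borel_measurable M\<close> \<open>g \<in> borel_measurable N\<close>)
qed

section \<open>Orthants and closed upper sets\<close>

lemma borel_eq_atLeast_vec: "borel = sigma UNIV (range (\<lambda>a :: real ^ 'd. {a..}))"
  (is "_ = ?SIGMA")
proof (rule borel_eq_sigmaI4[OF borel_eq_halfspace_ge])
  fix a :: real and i :: "real ^ 'd" assume "(a, i) \<in> UNIV \<times> Basis"
  then obtain j where i: "i = axis j 1" by (auto simp: Basis_vec_def)
  \<comment> \<open>The half-space is exhausted by orthants whose corner keeps \<open>a\<close> in
    coordinate \<open>j\<close> and tends to minus infinity in all others.\<close>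
  have *: "{x :: real ^ 'd. a \<le> x \<bullet> i} =
    (\<Union>k::nat. {(\<chi> n. if n = j then a else - real k)..})"
  proof (intro subset_antisym subsetI)
    fix x :: "real ^ 'd" assume x: "x \<in> {x. a \<le> x \<bullet> i}"
    obtain k where k: "norm x \<le> real k" using real_arch_simple by blast
    have "- real k \<le> x $ n" for n
      using component_le_norm_cart[of x n] k by linarith
    with x show "x \<in> (\<Union>k::nat. {(\<chi> n. if n = j then a else - real k)..})"
      by (auto simp: i inner_axis less_eq_vec_def)
  qed (auto simp: i inner_axis less_eq_vec_def dest!: spec[of _ j])
  show "{x. a \<le> x \<bullet> i} \<in> ?SIGMA" unfolding *
    by (intro sets.countable_UN) auto
qed auto

text \<open>Orthants form a pi-system, with the componentwise maximum as corner of an intersection,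
  and those with all corner coordinates equal to \<open>- real n\<close> exhaust the space with
  finite mass.\<close>

lemma measure_eqI_atLeast_vec:
  fixes M N :: "(real ^ 'd) measure"
  assumes sets: "sets M = sets borel" "sets N = sets borel"
    and eq: "\<And>a. emeasure M {a..} = emeasure N {a..}" and fin: "\<And>a. emeasure M {a..} < \<infinity>"
  shows "M = N"
proof (rule measure_eqI_generator_eq)
  have b: "sets (borel :: (real ^ 'd) measure) = sigma_sets UNIV (range (\<lambda>a. {a..}))"
    by (subst borel_eq_atLeast_vec) simp
  show "sets M = sigma_sets UNIV (range (\<lambda>a. {a..}))" "sets N = sigma_sets UNIV (range (\<lambda>a. {a..}))"
    using sets b by auto
  show "Int_stable (range (\<lambda>a :: real ^ 'd. {a..}))"
  proof (rule Int_stableI_image)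
    fix x y :: "real ^ 'd"
    have "{x..} \<inter> {y..} = {(\<chi> i. max (x $ i) (y $ i))..}"
      by (auto simp: less_eq_vec_def)
    then show "\<exists>z\<in>UNIV. {x..} \<inter> {y..} = {z..}" by blast
  qed
  show "range (\<lambda>n::nat. {(\<chi> i. - real n) :: real ^ 'd ..}) \<subseteq> range (\<lambda>a. {a..})" by auto
  show "(\<Union>n::nat. {(\<chi> i. - real n) :: real ^ 'd ..}) = UNIV"
  proof (intro subset_antisym subsetI)
    fix x :: "real ^ 'd"
    obtain k where k: "norm x \<le> real k" using real_arch_simple by blast
    have "- real k \<le> x $ n" for n
      using component_le_norm_cart[of x n] k by linarith
    then show "x \<in> (\<Union>n::nat. {(\<chi> i. - real n) :: real ^ 'd ..})"
      by (auto simp: less_eq_vec_def)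
  qed simp
qed (use eq fin in \<open>auto simp: less_top\<close>)

text \<open>Orthants are thus admissible reports, so scores can be compared on a generator of the
  Borel sets.\<close>

lemma atLeast_closed_upper: "{a :: real ^ 'd ..} \<in> closed_upper_sets"
proof -
  have up: "{a..} = {b + x | b x. b \<in> {a..} \<and> 0 \<le> x}"
    by (auto simp: less_eq_vec_def intro: add_increasing2)
      (rule_tac x = a in exI, rule_tac x = "x - a" in exI, simp)
  have cl: "closed {a..}"
  proof -
    have "{a..} = (\<Inter>i. {x. a $ i \<le> x $ i})"
      by (auto simp: less_eq_vec_def)
    then show ?thesis
      by (auto intro!: closed_INT closed_Collect_le continuous_intros)
  qed
  have "(\<chi> i. a $ i - 1) \<notin> {a..}"
    by (simp add: less_eq_vec_def)
  then have "{a..} \<noteq> UNIV" by (metis UNIV_I)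
  then show ?thesis
    unfolding closed_upper_sets_def mem_Collect_eq by (intro conjI cl up)
qed

lemma borel_closed_upper: "A \<in> closed_upper_sets \<Longrightarrow> A \<in> sets borel"
  by (simp add: closed_upper_sets_def)

text \<open>The score of this report is the total mass of the positive part of \<open>V\<close>,
  which links an orthant to its complement.\<close>

lemma empty_closed_upper: "{} \<in> closed_upper_sets"
  by (simp add: closed_upper_sets_def)

section \<open>Scaling of reports and measures\<close>

text \<open>Homogeneity is stated with images, whereas pushforwards produce preimages.\<close>

lemma vimage_scaleR_eq_image:
  fixes c :: real and A :: "'a :: real_vector set"
  assumes "c > 0"
  shows "(\<lambda>k. (1 / c) *\<^sub>R k) -` A = (\<lambda>k. c *\<^sub>R k) ` A"
proof (intro subset_antisym subsetI)
  fix x assume "x \<in> (\<lambda>k. (1 / c) *\<^sub>R k) -` A"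
  then have "(1 / c) *\<^sub>R x \<in> A" by simp
  moreover have "x = c *\<^sub>R ((1 / c) *\<^sub>R x)" using assms by simp
  ultimately show "x \<in> (\<lambda>k. c *\<^sub>R k) ` A" by (rule image_eqI[rotated])
qed (use assms in auto)

text \<open>Keeps the scaled report in the class on which \<open>S\<close> is known to equal a
  mixture score.\<close>

lemma scaleR_closed_upper:
  fixes A :: "(real ^ 'd) set"
  assumes A: "A \<in> closed_upper_sets" and c: "c > 0"
  shows "(\<lambda>k. c *\<^sub>R k) ` A \<in> closed_upper_sets"
proof -
  have eq: "(\<lambda>k. c *\<^sub>R k) ` A = {k. (1 / c) *\<^sub>R k \<in> A}"
    using vimage_scaleR_eq_image[OF c, of A] by blast
  have up: "b + x \<in> A" if "b \<in> A" "0 \<le> x" for b x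
    using A that by (auto simp: closed_upper_sets_def)
  have "closed ((\<lambda>k. c *\<^sub>R k) ` A)"
    using A by (intro closed_scaling) (auto simp: closed_upper_sets_def)
  moreover have "(\<lambda>k. c *\<^sub>R k) ` A = {b + x | b x. b \<in> (\<lambda>k. c *\<^sub>R k) ` A \<and> 0 \<le> x}"
  proof (intro subset_antisym subsetI)
    fix z assume "z \<in> {b + x | b x. b \<in> (\<lambda>k. c *\<^sub>R k) ` A \<and> 0 \<le> x}"
    then obtain b x where z: "z = b + x" "(1 / c) *\<^sub>R b \<in> A" "0 \<le> x" by (auto simp: eq)
    have "0 \<le> (1 / c) *\<^sub>R x"
      using z(3) c by (simp add: less_eq_vec_def)
    then show "z \<in> (\<lambda>k. c *\<^sub>R k) ` A"
      using up z by (auto simp: eq scaleR_add_right)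
  qed (force intro: exI[of _ 0])
  moreover have "(\<lambda>k. c *\<^sub>R k) ` A \<noteq> UNIV"
  proof
    assume "(\<lambda>k. c *\<^sub>R k) ` A = UNIV"
    then have "(1 / c) *\<^sub>R (c *\<^sub>R x) \<in> A" for x
      unfolding eq by blast
    then show False
      using A c by (auto simp: closed_upper_sets_def)
  qed
  ultimately show ?thesis by (simp add: closed_upper_sets_def)
qed

text \<open>Substituting \<open>(1 / c) *\<^sub>R k\<close> for \<open>k\<close> moves the scaling
  of report and observation onto the measure, while homogeneity of \<open>V\<close> releases the
  factor \<open>c powr a\<close>. As \<open>\<pi>\<close> is an arbitrary Borel measure, both parts
  of the theorem can start from this identity.\<close>

lemma mixture_score_scaleR:
  fixes V :: "real ^ 'd \<Rightarrow> real ^ 'd \<Rightarrow> real"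
  assumes V: "(\<lambda>(k, y). V k y) \<in> borel_measurable borel"
    and or: "pointwise_oriented \<rho> \<Lambda> V" and hom: "pos_homogeneous_fun a V"
    and \<pi>: "sets \<pi> = sets borel" and c: "c > 0" and A: "A \<in> closed_upper_sets"
  shows "mixture_score \<rho> \<Lambda> V \<pi> ((\<lambda>k. c *\<^sub>R k) ` A) (c *\<^sub>R y) =
    ennreal (c powr a) * mixture_score \<rho> \<Lambda> V (distr \<pi> borel (\<lambda>k. (1 / c) *\<^sub>R k)) A y"
proof -
  have [measurable]: "A \<in> sets borel" using A by (rule borel_closed_upper)
  have [measurable]: "(\<lambda>k. V k y) \<in> borel_measurable borel" for y
    using measurable_compose[OF _ V, of "\<lambda>k. (k, y)" borel] by simp
  have [measurable]: "(\<lambda>k. (1 / c) *\<^sub>R k) \<in> measurable \<pi> borel"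
    by (subst measurable_cong_sets[OF \<pi> refl]) measurable
  have inA: "k \<in> (\<lambda>k. c *\<^sub>R k) ` A \<longleftrightarrow> (1 / c) *\<^sub>R k \<in> A" for k
    using vimage_scaleR_eq_image[OF c, of A] by blast
  have Vs: "V k (c *\<^sub>R y) = c powr a * V ((1 / c) *\<^sub>R k) y" for k
    using c pos_homogeneous_fun_def[THEN iffD1, OF hom, rule_format, OF c, of "(1 / c) *\<^sub>R k" y] by simp
  let ?g = "\<lambda>k. if k \<in> A then ennreal (- V k y) else ennreal (V k y)"
  have "mixture_score \<rho> \<Lambda> V \<pi> ((\<lambda>k. c *\<^sub>R k) ` A) (c *\<^sub>R y) =
      (\<integral>\<^sup>+ k. ennreal (c powr a) * ?g ((1 / c) *\<^sub>R k) \<partial>\<pi>)"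
    unfolding mixture_score_eq[OF or] inA Vs
    by (intro nn_integral_cong) (auto simp: ennreal_mult'[symmetric])
  also have "\<dots> = ennreal (c powr a) * (\<integral>\<^sup>+ k. ?g ((1 / c) *\<^sub>R k) \<partial>\<pi>)"
    by (rule nn_integral_cmult) measurable
  also have "(\<integral>\<^sup>+ k. ?g ((1 / c) *\<^sub>R k) \<partial>\<pi>) = (\<integral>\<^sup>+ k. ?g k \<partial>distr \<pi> borel (\<lambda>k. (1 / c) *\<^sub>R k))"
    by (rule nn_integral_distr[symmetric]) measurable
  finally show ?thesis unfolding mixture_score_eq[OF or] .
qed

lemma mixture_score_scale_measure:
  fixes V :: "real ^ 'd \<Rightarrow> real ^ 'd \<Rightarrow> real"
  assumes V: "(\<lambda>(k, y). V k y) \<in> borel_measurable borel"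
    and or: "pointwise_oriented \<rho> \<Lambda> V"
    and \<pi>: "sets \<pi> = sets borel" and A: "A \<in> closed_upper_sets"
  shows "mixture_score \<rho> \<Lambda> V (scale_measure r \<pi>) A y = r * mixture_score \<rho> \<Lambda> V \<pi> A y"
proof -
  have [measurable]: "A \<in> sets borel" using A by (rule borel_closed_upper)
  have [measurable]: "(\<lambda>k. V k y) \<in> borel_measurable borel"
    using measurable_compose[OF _ V, of "\<lambda>k. (k, y)" borel] by simp
  have "(\<lambda>k. if k \<in> A then ennreal (- V k y) else ennreal (V k y)) \<in> borel_measurable \<pi>"
    by (subst measurable_cong_sets[OF \<pi> refl]) measurable
  then show ?thesis
    unfolding mixture_score_eq[OF or] by (rule nn_integral_scale_measure)
qed

text \<open>The preimage of \<open>A\<close> under division by \<open>c\<close> is \<open>c\<close>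
  times \<open>A\<close>. Homogeneity thereby becomes an identity of measures, the form that a
  uniqueness result can deliver.\<close>

lemma distr_scaleR_pos_homogeneous:
  fixes \<pi> :: "(real ^ 'd) measure"
  assumes \<pi>: "sets \<pi> = sets borel"
  shows "pos_homogeneous_measure b \<pi> \<longleftrightarrow>
    (\<forall>c>0. distr \<pi> borel (\<lambda>k. (1 / c) *\<^sub>R k) = scale_measure (ennreal (c powr b)) \<pi>)"
proof -
  have "emeasure (distr \<pi> borel (\<lambda>k. (1 / c) *\<^sub>R k)) A = emeasure \<pi> ((\<lambda>k. c *\<^sub>R k) ` A)"
    if c: "c > 0" and A: "A \<in> sets borel" for c A
  proof -
    have [measurable]: "(\<lambda>k. (1 / c) *\<^sub>R k) \<in> measurable \<pi> borel"
      by (subst measurable_cong_sets[OF \<pi> refl]) measurable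
    then show ?thesis
      using A c sets_eq_imp_space_eq[OF \<pi>] by (simp add: emeasure_distr vimage_scaleR_eq_image)
  qed
  then show ?thesis
    using \<pi> by (auto simp: pos_homogeneous_measure_def emeasure_scale_measure
        intro!: measure_eqI dest: arg_cong[where f = emeasure])
qed

lemma pos_homogeneous_mixture_score:
  fixes V :: "real ^ 'd \<Rightarrow> real ^ 'd \<Rightarrow> real"
  assumes V: "(\<lambda>(k, y). V k y) \<in> borel_measurable borel"
    and or: "pointwise_oriented \<rho> \<Lambda> V" and hom: "pos_homogeneous_fun a V"
    and \<pi>: "sets \<pi> = sets borel" "pos_homogeneous_measure b \<pi>"
  shows "pos_homogeneous_score (a + b) (mixture_score \<rho> \<Lambda> V \<pi>)"
  unfolding pos_homogeneous_score_def
proof safe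
  fix c :: real and A :: "(real ^ 'd) set" and y
  assume c: "c > 0" and A: "A \<in> closed_upper_sets"
  have "distr \<pi> borel (\<lambda>k. (1 / c) *\<^sub>R k) = scale_measure (ennreal (c powr b)) \<pi>"
    using \<pi> c by (simp add: distr_scaleR_pos_homogeneous)
  then show "mixture_score \<rho> \<Lambda> V \<pi> ((\<lambda>k. c *\<^sub>R k) ` A) (c *\<^sub>R y) =
      ennreal (c powr (a + b)) * mixture_score \<rho> \<Lambda> V \<pi> A y"
    by (simp add: mixture_score_scaleR[OF V or hom \<pi>(1) c A]
        mixture_score_scale_measure[OF V or \<pi>(1) A] powr_add ennreal_mult mult.assoc)
qed

section \<open>Uniqueness of the mixing measure\<close>

text \<open>With \<open>p\<close> and \<open>n\<close> the measures of density
  \<open>V\<^sup>+\<close> and \<open>V\<^sup>-\<close> for fixed \<open>y\<close>, the score of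
  \<open>A\<close> is \<open>n A + p (- A)\<close>, that is, the total mass of \<open>p\<close> plus
  \<open>n A - p A\<close>. Orthants and \<open>{}\<close> thus fix \<open>n - p\<close>, and
  \<open>p\<close> vanishes where \<open>V\<close> is negative.\<close>

lemma mixture_score_determines_negative_part:
  fixes V :: "real ^ 'd \<Rightarrow> real ^ 'd \<Rightarrow> real"
  assumes V: "(\<lambda>(k, y). V k y) \<in> borel_measurable borel"
    and or: "pointwise_oriented \<rho> \<Lambda> V"
    and sets: "sets \<pi> = sets borel" "sets \<pi>' = sets borel"
    and fin: "\<And>A. A \<in> closed_upper_sets \<Longrightarrow> mixture_score \<rho> \<Lambda> V \<pi> A y < \<infinity>"
    and eq: "\<And>A. A \<in> closed_upper_sets \<Longrightarrow>
      mixture_score \<rho> \<Lambda> V \<pi> A y = mixture_score \<rho> \<Lambda> V \<pi>' A y"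
    and B: "B \<in> sets borel" "B \<subseteq> {k. V k y < 0}"
  shows "emeasure \<pi> B = emeasure \<pi>' B"
proof -
  have Vb[measurable]: "(\<lambda>k. V k y) \<in> borel_measurable borel"
    using measurable_compose[OF _ V, of "\<lambda>k. (k, y)" borel] by simp
  have V1[measurable]: "(\<lambda>k. V k y) \<in> borel_measurable \<pi>" "(\<lambda>k. V k y) \<in> borel_measurable \<pi>'"
    using Vb by (simp_all cong: measurable_cong_sets add: sets)
  \<comment> \<open>Subtracting \<open>V\<^sup>+\<close>-masses is replaced by comparing \<open>V\<^sup>-\<pi> + V\<^sup>+\<pi>'\<close> with \<open>V\<^sup>-\<pi>' + V\<^sup>+\<pi>\<close>.\<close>
  define p n where "p L = density L (\<lambda>k. ennreal (V k y))"
    and "n L = density L (\<lambda>k. ennreal (- V k y))" for L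
  have sp: "sets (p L) = sets L" "sets (n L) = sets L" for L by (auto simp: p_def n_def)
  have score: "mixture_score \<rho> \<Lambda> V L A y = emeasure (n L) A + emeasure (p L) (- A)"
    if L: "sets L = sets borel" and A: "A \<in> closed_upper_sets" for L A
  proof -
    have [measurable]: "A \<in> sets L" "- A \<in> sets L"
      using A L by (auto simp: closed_upper_sets_def)
    have [measurable]: "(\<lambda>k. V k y) \<in> borel_measurable L"
      using Vb by (simp cong: measurable_cong_sets add: L)
    have "emeasure (n L) A + emeasure (p L) (- A) =
      (\<integral>\<^sup>+ k. ennreal (- V k y) * indicator A k + ennreal (V k y) * indicator (- A) k \<partial>L)"
      by (simp add: n_def p_def emeasure_density nn_integral_add)
    then show ?thesis unfolding mixture_score_eq[OF or]
      by (auto intro!: nn_integral_cong simp: indicator_def)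
  qed
  \<comment> \<open>The report \<open>{}\<close> yields the whole mass of \<open>p L\<close>, here
    split at \<open>A\<close>.\<close>
  have tot: "emeasure (p L) A + emeasure (p L) (- A) = mixture_score \<rho> \<Lambda> V L {} y"
    if L: "sets L = sets borel" and A: "A \<in> sets borel" for L A
  proof -
    have "emeasure (p L) A + emeasure (p L) (- A) = emeasure (p L) (A \<union> - A)"
      using that by (intro plus_emeasure) (auto simp: sp)
    then show ?thesis using score[OF L empty_closed_upper] by simp
  qed
  obtain K where K: "sets K = sets borel"
      "\<And>A. A \<in> sets borel \<Longrightarrow> emeasure K A = emeasure (n \<pi>) A + emeasure (p \<pi>') A"
    using emeasure_sum_measure_exists[of "p \<pi>'" "n \<pi>"] by (auto simp: sp sets)
  obtain K' where K': "sets K' = sets borel"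
      "\<And>A. A \<in> sets borel \<Longrightarrow> emeasure K' A = emeasure (n \<pi>') A + emeasure (p \<pi>) A"
    using emeasure_sum_measure_exists[of "p \<pi>" "n \<pi>'"] by (auto simp: sp sets)
  have orthant: "emeasure K {u..} = emeasure K' {u..} \<and> emeasure K {u..} < \<infinity>" for u
  proof -
    have A: "{u..} \<in> closed_upper_sets" by (rule atLeast_closed_upper)
    then have A': "{u..} \<in> sets borel" by (rule borel_closed_upper)
    define t where "t = mixture_score \<rho> \<Lambda> V \<pi> {} y"
    define s where "s = mixture_score \<rho> \<Lambda> V \<pi> {u..} y"
    have t: "t < \<infinity>" "emeasure (p \<pi>) {u..} + emeasure (p \<pi>) (- {u..}) = t"
      "emeasure (p \<pi>') {u..} + emeasure (p \<pi>') (- {u..}) = t"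
      using tot[OF sets(1) A'] tot[OF sets(2) A'] fin[OF empty_closed_upper] eq[OF empty_closed_upper]
      by (auto simp: t_def)
    have s: "s < \<infinity>" "emeasure (n \<pi>) {u..} + emeasure (p \<pi>) (- {u..}) = s"
      "emeasure (n \<pi>') {u..} + emeasure (p \<pi>') (- {u..}) = s"
      using score[OF sets(1) A] score[OF sets(2) A] fin[OF A] eq[OF A] by (auto simp: s_def)
    \<comment> \<open>Here \<open>a\<close> stands for the \<open>n\<close>-mass of the orthant,
      \<open>q\<close> and \<open>r\<close> for the \<open>p\<close>-mass inside and outside it.
      Finiteness of \<open>t\<close> and \<open>s\<close> makes all six terms finite, so
      \<open>r1 + r2\<close> may be cancelled.\<close>
    have *: "a1 + q2 = a2 + q1 \<and> a1 + q2 < \<infinity>"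
      if "t < \<infinity>" "s < \<infinity>" "q1 + r1 = t" "q2 + r2 = t" "a1 + r1 = s" "a2 + r2 = s"
      for a1 a2 q1 q2 r1 r2 t s :: ennreal
    proof -
      have lt: "q1 < \<infinity>" "q2 < \<infinity>" "r1 < \<infinity>" "r2 < \<infinity>" "a1 < \<infinity>" "a2 < \<infinity>"
        using that(1)[folded that(3)] that(1)[folded that(4)] that(2)[folded that(5)]
          that(2)[folded that(6)] by (auto simp: less_top[symmetric])
      have "(r1 + r2) + (a1 + q2) = (a1 + r1) + (q2 + r2)" by (simp add: ac_simps)
      also have "\<dots> = (a2 + r2) + (q1 + r1)" using that by simp
      also have "\<dots> = (r1 + r2) + (a2 + q1)" by (simp add: ac_simps)
      finally have "a1 + q2 = a2 + q1"
        using lt by (subst (asm) ennreal_add_left_cancel) (auto simp: less_top[symmetric])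
      with lt show ?thesis by (auto simp: less_top[symmetric])
    qed
    show ?thesis
      using *[OF t(1) s(1) t(2,3) s(2,3)] unfolding K(2)[OF A'] K'(2)[OF A'] .
  qed
  have KK: "K = K'"
    by (rule measure_eqI_atLeast_vec[OF K(1) K'(1)]) (use orthant in blast)+
  \<comment> \<open>Where \<open>V\<close> is negative the \<open>p\<close>-summands of
    \<open>K\<close> and \<open>K'\<close> are null, so only the \<open>n\<close>-summands
    remain.\<close>
  have neg: "emeasure (n \<pi>) C = emeasure (n \<pi>') C" if C: "C \<in> sets borel" "C \<subseteq> {k. V k y < 0}" for C
  proof -
    have "emeasure (p L) C = 0" if L: "sets L = sets borel" for L
    proof -
      have "(\<lambda>k. V k y) \<in> borel_measurable L"
        using Vb by (simp cong: measurable_cong_sets add: L)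
      then have "emeasure (p L) C = (\<integral>\<^sup>+ k. ennreal (V k y) * indicator C k \<partial>L)"
        using C L by (simp add: p_def emeasure_density)
      also have "\<dots> = (\<integral>\<^sup>+ k. 0 \<partial>L)"
        using C by (intro nn_integral_cong) (auto simp: indicator_def ennreal_neg)
      finally show ?thesis by simp
    qed
    then show ?thesis using K(2)[OF C(1)] K'(2)[OF C(1)] KK sets by simp
  qed
  show ?thesis
  proof (rule emeasure_eq_on_support[where f = "\<lambda>k. ennreal (- V k y)"])
    fix C assume C: "C \<in> sets \<pi>" "C \<subseteq> {k. ennreal (- V k y) \<noteq> 0}"
    then have "emeasure (n \<pi>) C = emeasure (n \<pi>') C"
      by (intro neg) (auto simp: sets ennreal_eq_0_iff not_le)
    then show "(\<integral>\<^sup>+ k. ennreal (- V k y) * indicator C k \<partial>\<pi>) =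
        (\<integral>\<^sup>+ k. ennreal (- V k y) * indicator C k \<partial>\<pi>')"
      using C by (simp add: n_def emeasure_density sets)
  qed (use B in \<open>auto simp: sets ennreal_eq_0_iff not_le\<close>)
qed

text \<open>The measures agree inside each section of \<open>P\<close> at fixed \<open>y\<close>.
  Averaging the sections over \<open>F n\<close> shows that both measures agree after weighting by
  \<open>h n\<close>, a finite density that can be divided out where it is non-zero; countably many
  such sets cover the space.\<close>

lemma measure_eqI_mixture:
  fixes M N :: "'a measure" and F :: "nat \<Rightarrow> 'b measure" and P :: "('a \<times> 'b) set"
  assumes sets: "sets N = sets M" and sf: "sigma_finite_measure M" "sigma_finite_measure N"
    and F: "\<And>n. prob_space (F n)" "\<And>n. sets (F n) = sets L"
    and P: "P \<in> sets (M \<Otimes>\<^sub>M L)"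
    and eq: "\<And>y B. y \<in> space L \<Longrightarrow> B \<in> sets M \<Longrightarrow> B \<subseteq> {x. (x, y) \<in> P} \<Longrightarrow>
      emeasure M B = emeasure N B"
    and cover: "\<And>x. x \<in> space M \<Longrightarrow> \<exists>n. emeasure (F n) {y. (x, y) \<in> P} \<noteq> 0"
  shows "M = N"
proof -
  define h where "h n x = emeasure (F n) {y. (x, y) \<in> P}" for n x
  have P': "P \<in> sets (M \<Otimes>\<^sub>M F n)" for n
    using P F(2)[of n] by (simp cong: sets_pair_measure_cong)
  have vim: "Pair x -` P = {y. (x, y) \<in> P}" for x by auto
  have hM: "h n \<in> borel_measurable M" for n
  proof -
    interpret F: prob_space "F n" by (rule F)
    show ?thesis
      using F.measurable_emeasure_Pair[OF P'] by (simp add: h_def[abs_def] vim)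
  qed
  \<comment> \<open>Both sides are the product measure of the part \<open>Q\<close> of
    \<open>P\<close> above \<open>B\<close>, computed in the two orders of integration.\<close>
  have swap: "(\<integral>\<^sup>+ x. h n x * indicator B x \<partial>K) = (\<integral>\<^sup>+ y. emeasure K (B \<inter> {x. (x, y) \<in> P}) \<partial>F n)"
    if B: "B \<in> sets K" and K: "sigma_finite_measure K" "sets K = sets M" for K B n
  proof -
    interpret F: prob_space "F n" by (rule F)
    interpret K: sigma_finite_measure K by (rule K)
    interpret KF: pair_sigma_finite K "F n" ..
    have PK: "P \<in> sets (K \<Otimes>\<^sub>M F n)"
      using P K(2) F(2)[of n] by (simp cong: sets_pair_measure_cong)
    define Q where "Q = P \<inter> (B \<times> space (F n))"
    have Q: "Q \<in> sets (K \<Otimes>\<^sub>M F n)" using PK B unfolding Q_def by auto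
    have PS: "P \<subseteq> space K \<times> space (F n)"
      using sets.sets_into_space[OF PK] by (simp add: space_pair_measure)
    have "Pair x -` Q = (if x \<in> B then {y. (x, y) \<in> P} else {})" for x
      using PS by (auto simp: Q_def)
    then have "(\<integral>\<^sup>+ x. h n x * indicator B x \<partial>K) = (\<integral>\<^sup>+ x. emeasure (F n) (Pair x -` Q) \<partial>K)"
      by (intro nn_integral_cong) (auto simp: h_def)
    also have "\<dots> = emeasure (K \<Otimes>\<^sub>M F n) Q"
      by (rule F.emeasure_pair_measure_alt[OF Q, symmetric])
    also have "\<dots> = (\<integral>\<^sup>+ y. emeasure K ((\<lambda>x. (x, y)) -` Q) \<partial>F n)"
      by (rule KF.emeasure_pair_measure_alt2[OF Q])
    also have "\<dots> = (\<integral>\<^sup>+ y. emeasure K (B \<inter> {x. (x, y) \<in> P}) \<partial>F n)"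
      by (intro nn_integral_cong arg_cong2[where f = emeasure]) (auto simp: Q_def)
    finally show ?thesis .
  qed
  have sections: "{x. (x, y) \<in> P} \<in> sets M" for y
    using sets_Pair2[OF P, of y] by (simp add: vimage_def)
  show ?thesis
  proof (rule emeasure_eq_countable_cover[where C = "\<lambda>n. {x \<in> space M. h n x \<noteq> 0}", OF sets])
    show "range (\<lambda>n. {x \<in> space M. h n x \<noteq> 0}) \<subseteq> sets M"
      using hM by (auto intro!: measurable_sets_borel)
    show "space M \<subseteq> (\<Union>n. {x \<in> space M. h n x \<noteq> 0})"
      using cover by (auto simp: h_def)
    fix n B assume B: "B \<in> sets M" "B \<subseteq> {x \<in> space M. h n x \<noteq> 0}"
    interpret F: prob_space "F n" by (rule F)
    show "emeasure M B = emeasure N B"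
    proof (rule emeasure_eq_on_support[OF sets hM[of n]])
      show "h n x < \<infinity>" for x by (simp add: h_def less_top[symmetric])
      fix C assume C: "C \<in> sets M"
      have "emeasure M (C \<inter> {x. (x, y) \<in> P}) = emeasure N (C \<inter> {x. (x, y) \<in> P})"
        if "y \<in> space (F n)" for y
        using that C sections sets_eq_imp_space_eq[OF F(2)[of n]] by (intro eq[of y]) auto
      then show "(\<integral>\<^sup>+ x. h n x * indicator C x \<partial>M) = (\<integral>\<^sup>+ x. h n x * indicator C x \<partial>N)"
        using C sets sf by (simp add: swap cong: nn_integral_cong)
    qed (use B in auto)
  qed
qed

text \<open>If \<open>f\<close> were almost everywhere non-negative, its negative part would
  integrate to 0, leaving the non-negative integral of the positive part, possibly infinite.\<close>

lemma has_negative_values_if_ext_integral_neg: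
  assumes f: "f \<in> borel_measurable F" and neg: "ext_integral F f < 0"
  shows "emeasure F {y \<in> space F. f y < 0} \<noteq> 0"
proof
  note f[measurable]
  assume "emeasure F {y \<in> space F. f y < 0} = 0"
  then have "AE y in F. \<not> f y < 0"
    by (subst AE_iff_measurable[OF _ refl]) auto
  then have "(\<integral>\<^sup>+ y. ennreal (- f y) \<partial>F) = (\<integral>\<^sup>+ y. 0 \<partial>F)"
    by (intro nn_integral_cong_AE) (auto simp: ennreal_neg)
  then have "ext_integral F f = enn2ereal (\<integral>\<^sup>+ y. ennreal (f y) \<partial>F)"
    by (simp add: ext_integral_def zero_ennreal.rep_eq)
  then have "0 \<le> ext_integral F f"
    by (simp add: enn2ereal_nonneg)
  with neg show False using leD by blast
qed

text \<open>Each \<open>y\<close> gives agreement on the section where \<open>V\<close> is negative;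
  laws of countably many translates of one vector make these sections reach every
  \<open>k\<close>.\<close>

lemma mixture_score_determines_measure:
  fixes M :: "'w measure" and V :: "real ^ 'd \<Rightarrow> real ^ 'd \<Rightarrow> real"
  assumes setting: "systemic_risk_setting M \<Y>d \<Y> \<Lambda> \<rho>"
    and upper: "\<And>Y. Y \<in> \<Y>d \<Longrightarrow> risk_set \<rho> \<Lambda> Y \<in> closed_upper_sets"
    and V: "(\<lambda>(k, y). V k y) \<in> borel_measurable borel"
    and ident: "oriented_strict_selective_identification M \<Y>d \<rho> \<Lambda> V"
    and or: "pointwise_oriented \<rho> \<Lambda> V"
    and \<pi>: "borel_sigma_finite \<pi>" "borel_sigma_finite \<pi>'"
    and fin: "finite_score (mixture_score \<rho> \<Lambda> V \<pi>)"
    and eq: "\<And>A y. A \<in> closed_upper_sets \<Longrightarrow>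
      mixture_score \<rho> \<Lambda> V \<pi> A y = mixture_score \<rho> \<Lambda> V \<pi>' A y"
  shows "\<pi> = \<pi>'"
proof -
  interpret systemic_risk_setting M \<Y>d \<Y> \<Lambda> \<rho> by (rule setting)
  obtain Y where Y: "Y \<in> \<Y>d" using vectors_nonempty by auto
  \<comment> \<open>A countable dense set of translation vectors, enumerated below by
    \<open>from_nat_into\<close>.\<close>
  obtain D :: "(real ^ 'd) set" where D: "countable D"
    "\<And>X. open X \<Longrightarrow> X \<noteq> {} \<Longrightarrow> \<exists>d\<in>D. d \<in> X"
    by (rule countable_dense_setE) blast
  have "D \<noteq> {}" using D(2)[of UNIV] by auto
  define Z where "Z n \<omega> = Y \<omega> + from_nat_into D n" for n \<omega>
  have Z: "Z n \<in> \<Y>d" for n unfolding Z_def using Y by (rule vectors_translate)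
  then have Zm[measurable]: "Z n \<in> borel_measurable M" for n using vectors_measurable by auto
  have \<pi>s: "sets \<pi> = sets borel" "sets \<pi>' = sets borel"
    using \<pi> by (auto simp: borel_sigma_finite_def)
  \<comment> \<open>Probabilities of this set are used instead of means of \<open>V\<^sup>-\<close>, which may be infinite.\<close>
  let ?P = "{(k, y). V k y < 0}"
  show ?thesis
  proof (rule measure_eqI_mixture[where P = ?P and L = borel and F = "\<lambda>n. distr M borel (Z n)"])
    show "sigma_finite_measure \<pi>" "sigma_finite_measure \<pi>'"
      using \<pi> by (auto simp: borel_sigma_finite_def)
    show "prob_space (distr M borel (Z n))" for n by (rule prob_space_distr) measurable
    have "?P = (\<lambda>(k, y). V k y) -` {..<0} \<inter> space borel" by auto
    also have "\<dots> \<in> sets borel" using V by (rule measurable_sets) auto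
    also have "sets borel = sets (\<pi> \<Otimes>\<^sub>M (borel :: (real ^ 'd) measure))"
      by (simp add: borel_prod[symmetric] \<pi>s cong: sets_pair_measure_cong)
    finally show "?P \<in> sets (\<pi> \<Otimes>\<^sub>M borel)" .
    show "emeasure \<pi> B = emeasure \<pi>' B" if "B \<in> sets \<pi>" "B \<subseteq> {k. (k, y) \<in> ?P}" for y B
      using that fin eq by (intro mixture_score_determines_negative_part[OF V or \<pi>s])
        (auto simp: finite_score_def \<pi>s)
    fix k
    \<comment> \<open>Translating \<open>Y\<close> by \<open>d\<close> shifts its risk set by
      \<open>- d\<close>, so \<open>d\<close> must satisfy
      \<open>d + k \<notin> risk_set \<rho> \<Lambda> Y\<close>. Such \<open>d\<close> form a
      non-empty open set, which meets \<open>D\<close>.\<close>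
    have "open ((\<lambda>d. d + k) -` (- risk_set \<rho> \<Lambda> Y))"
      using upper[OF Y] by (intro open_vimage) (auto simp: closed_upper_sets_def intro!: continuous_intros)
    moreover obtain u where "u \<notin> risk_set \<rho> \<Lambda> Y"
      using upper[OF Y] by (auto simp: closed_upper_sets_def)
    then have "u - k \<in> (\<lambda>d. d + k) -` (- risk_set \<rho> \<Lambda> Y)" by simp
    ultimately obtain d where d: "d \<in> D" "d + k \<notin> risk_set \<rho> \<Lambda> Y"
      using D(2) by (metis ComplD empty_iff vimageD)
    then obtain n where n: "from_nat_into D n = d"
      using D(1) from_nat_into_surj by metis
    have "k \<notin> risk_set \<rho> \<Lambda> (Z n)"
      using d(2) by (simp add: risk_set_def Z_def n add.assoc)
    then have "ext_integral (distr M borel (Z n)) (V k) < 0"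
      "has_ext_integral (distr M borel (Z n)) (V k)"
      using ident Z[of n] by (auto simp: oriented_strict_selective_identification_def Let_def)
    then show "\<exists>n. emeasure (distr M borel (Z n)) {y. (k, y) \<in> ?P} \<noteq> 0"
      using has_negative_values_if_ext_integral_neg[of "V k" "distr M borel (Z n)"]
      by (auto simp: has_ext_integral_def)
  qed (auto simp: \<pi>s)
qed

section \<open>Homogeneity of the mixing measure and conclusion\<close>

text \<open>The pushforward of \<open>\<pi>\<close> under division by \<open>c\<close> and the
  multiple of \<open>\<pi>\<close> by \<open>c powr b\<close> produce the same finite scores, so
  uniqueness identifies them.\<close>

lemma pos_homogeneous_measure_if_score:
  fixes M :: "'w measure" and V :: "real ^ 'd \<Rightarrow> real ^ 'd \<Rightarrow> real"
  assumes setting: "systemic_risk_setting M \<Y>d \<Y> \<Lambda> \<rho>"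
    and upper: "\<And>Y. Y \<in> \<Y>d \<Longrightarrow> risk_set \<rho> \<Lambda> Y \<in> closed_upper_sets"
    and V: "(\<lambda>(k, y). V k y) \<in> borel_measurable borel"
    and ident: "oriented_strict_selective_identification M \<Y>d \<rho> \<Lambda> V"
    and or: "pointwise_oriented \<rho> \<Lambda> V" and hom: "pos_homogeneous_fun a V"
    and \<pi>: "borel_sigma_finite \<pi>"
    and fin: "finite_score (mixture_score \<rho> \<Lambda> V \<pi>)"
    and score: "pos_homogeneous_score (a + b) (mixture_score \<rho> \<Lambda> V \<pi>)"
  shows "pos_homogeneous_measure b \<pi>"
proof -
  have \<pi>s: "sets \<pi> = sets borel" and sf: "sigma_finite_measure \<pi>"
    using \<pi> by (auto simp: borel_sigma_finite_def)
  show ?thesis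
    unfolding distr_scaleR_pos_homogeneous[OF \<pi>s]
  proof safe
    fix c :: real assume c: "c > 0"
    let ?D = "distr \<pi> borel (\<lambda>k. (1 / c) *\<^sub>R k)"
    let ?r = "ennreal (c powr b)"
    have r: "borel_sigma_finite (scale_measure ?r \<pi>)"
    proof -
      interpret sigma_finite_measure \<pi> by (rule sf)
      obtain A :: "nat \<Rightarrow> (real ^ 'd) set" where A: "range A \<subseteq> sets \<pi>" "(\<Union>i. A i) = space \<pi>"
        "\<And>i. emeasure \<pi> (A i) \<noteq> \<infinity>" using sigma_finite by metis
      then have "sigma_finite_measure (scale_measure ?r \<pi>)"
        by (intro sigma_finite_measure.intro exI[of _ "range A"])
          (auto simp: emeasure_scale_measure ennreal_mult_eq_top_iff space_scale_measure)
      then show ?thesis by (simp add: borel_sigma_finite_def \<pi>s)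
    qed
    \<comment> \<open>Both sides times \<open>c powr a\<close> equal the score of
      \<open>\<pi>\<close> at the scaled report and observation; this factor is positive and finite
      and cancels.\<close>
    have S: "mixture_score \<rho> \<Lambda> V (scale_measure ?r \<pi>) A y = mixture_score \<rho> \<Lambda> V ?D A y"
      if A: "A \<in> closed_upper_sets" for A y
    proof -
      have "ennreal (c powr a) * mixture_score \<rho> \<Lambda> V ?D A y =
          ennreal (c powr (a + b)) * mixture_score \<rho> \<Lambda> V \<pi> A y"
        using score c A mixture_score_scaleR[OF V or hom \<pi>s c A, of y]
        by (simp add: pos_homogeneous_score_def)
      also have "\<dots> = ennreal (c powr a) * (?r * mixture_score \<rho> \<Lambda> V \<pi> A y)"
        by (simp add: powr_add ennreal_mult mult.assoc)
      finally show ?thesis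
        using c by (simp add: ennreal_mult_cancel_left mixture_score_scale_measure[OF V or \<pi>s A])
    qed
    have D: "borel_sigma_finite ?D"
    proof -
      interpret sigma_finite_measure \<pi> by (rule sf)
      obtain A :: "nat \<Rightarrow> (real ^ 'd) set" where A: "range A \<subseteq> sets \<pi>" "(\<Union>i. A i) = space \<pi>"
        "\<And>i. emeasure \<pi> (A i) \<noteq> \<infinity>" using sigma_finite by metis
      have T[measurable]: "(\<lambda>k. (1 / c) *\<^sub>R k) \<in> measurable \<pi> borel"
        by (subst measurable_cong_sets[OF \<pi>s refl]) measurable
      have sp: "space \<pi> = UNIV" using sets_eq_imp_space_eq[OF \<pi>s] by simp
      \<comment> \<open>Chosen so that division by \<open>c\<close> pulls \<open>B i\<close> back to
        \<open>A i\<close>, which has finite mass.\<close>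
      define B where "B i = (\<lambda>k. c *\<^sub>R k) -` A i" for i
      have B: "B i \<in> sets borel" for i
        using A(1) measurable_sets_borel[of "\<lambda>k :: real ^ 'd. c *\<^sub>R k" borel "A i"]
        by (auto simp: B_def \<pi>s)
      moreover have "emeasure ?D (B i) = emeasure \<pi> (A i)" for i
        using c B by (subst emeasure_distr[OF T]) (auto simp: B_def sp vimage_def)
      moreover have "(\<Union>i. B i) = UNIV"
        using A(2) unfolding B_def vimage_UN[symmetric] sp by simp
      ultimately have "sigma_finite_measure ?D"
        using A(3) by (intro sigma_finite_measure.intro exI[of _ "range B"]) auto
      then show ?thesis by (simp add: borel_sigma_finite_def)
    qed
    show "?D = scale_measure ?r \<pi>"
      using fin
      by (intro mixture_score_determines_measure[OF setting upper V ident or r D, symmetric] S)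
        (auto simp: finite_score_def mixture_score_scale_measure[OF V or \<pi>s] ennreal_mult_less_top)
  qed
qed

theorem proposition4p6:
  fixes M :: "'w measure"
    and \<Y>d :: "('w \<Rightarrow> real ^ 'd) set"
    and \<Y> :: "('w \<Rightarrow> real) set"
    and \<Lambda> :: "real ^ 'd \<Rightarrow> real"
    and \<rho> :: "('w \<Rightarrow> real) \<Rightarrow> real"
    and V :: "real ^ 'd \<Rightarrow> real ^ 'd \<Rightarrow> real"
    and a :: real
  assumes "systemic_risk_setting M \<Y>d \<Y> \<Lambda> \<rho>"
    and "\<And>Y. Y \<in> \<Y>d \<Longrightarrow> risk_set \<rho> \<Lambda> Y \<in> closed_upper_sets"
    and "\<And>Y. Y \<in> \<Y>d \<Longrightarrow> risk_set0 \<rho> \<Lambda> Y = frontier (risk_set \<rho> \<Lambda> Y)"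
    and "(\<lambda>(k, y). V k y) \<in> borel_measurable borel"
    and "oriented_strict_selective_identification M \<Y>d \<rho> \<Lambda> V"
    and "pointwise_oriented \<rho> \<Lambda> V"
    and "pos_homogeneous_fun a V"
  shows "(\<forall>(\<pi> :: (real ^ 'd) measure) b.
            borel_sigma_finite \<pi> \<and> pos_homogeneous_measure b \<pi> \<longrightarrow>
            pos_homogeneous_score (a + b) (mixture_score \<rho> \<Lambda> V \<pi>)) \<and>
         (\<forall>b (S :: (real ^ 'd) set \<Rightarrow> real ^ 'd \<Rightarrow> ennreal) (\<pi>' :: (real ^ 'd) measure).
            finite_score S \<and> consistent_score M \<Y>d \<rho> \<Lambda> S \<and> borel_sigma_finite \<pi>' \<and>
            (\<forall>A\<in>closed_upper_sets. \<forall>y. S A y = mixture_score \<rho> \<Lambda> V \<pi>' A y) \<longrightarrow>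
            pos_homogeneous_score (a + b) S \<longrightarrow>
            (\<exists>(\<gamma> :: real) (\<pi> :: (real ^ 'd) measure).
               \<gamma> \<ge> 0 \<and> borel_sigma_finite \<pi> \<and> pos_homogeneous_measure b \<pi> \<and>
               (\<forall>A\<in>closed_upper_sets. \<forall>y. S A y = ennreal \<gamma> * mixture_score \<rho> \<Lambda> V \<pi> A y)))"
  (is "?I \<and> ?II")
proof
  show ?I
    using pos_homogeneous_mixture_score[OF assms(4,6,7)] by (auto simp: borel_sigma_finite_def)
  show ?II
  proof (intro allI impI)
    fix b :: real and S :: "(real ^ 'd) set \<Rightarrow> real ^ 'd \<Rightarrow> ennreal" and \<pi>' :: "(real ^ 'd) measure"
    assume *: "finite_score S \<and> consistent_score M \<Y>d \<rho> \<Lambda> S \<and> borel_sigma_finite \<pi>' \<and>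
        (\<forall>A\<in>closed_upper_sets. \<forall>y. S A y = mixture_score \<rho> \<Lambda> V \<pi>' A y)"
      and S: "pos_homogeneous_score (a + b) S"
    from * have "\<And>A y. A \<in> closed_upper_sets \<Longrightarrow> mixture_score \<rho> \<Lambda> V \<pi>' A y = S A y" by simp
    with * have "finite_score (mixture_score \<rho> \<Lambda> V \<pi>')"
      by (auto simp: finite_score_def)
    \<comment> \<open>\<open>S\<close> and the mixture score are known to agree only on closed upper
      sets, a class stable under scaling.\<close>
    moreover from * S have "pos_homogeneous_score (a + b) (mixture_score \<rho> \<Lambda> V \<pi>')"
      by (simp add: pos_homogeneous_score_def scaleR_closed_upper)
    ultimately have "pos_homogeneous_measure b \<pi>'"
      using * by (intro pos_homogeneous_measure_if_score[OF assms(1,2,4-7)]) auto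
    with * show "\<exists>\<gamma> \<pi>. \<gamma> \<ge> 0 \<and> borel_sigma_finite \<pi> \<and> pos_homogeneous_measure b \<pi> \<and>
        (\<forall>A\<in>closed_upper_sets. \<forall>y. S A y = ennreal \<gamma> * mixture_score \<rho> \<Lambda> V \<pi> A y)"
      by (intro exI[of _ 1] exI[of _ \<pi>']) simp
  qed
qed

end
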